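(* Let $T_{\max}(u_0)$ be the maximal time of existence of the solution $u$ of $$\partial_t u=\Delta u-au+|u|^{p-1}u\quad (x\in V,\ t>0),\qquad u(x,0)=u_0(x)\quad (x\in V).$$ (i) If $u_0\in\mathscr{W}$, then $T_{\max}(u_0)=+\infty$, $u(\cdot,t)\in\mathscr{W}$ for all $t>0$, and $\|u(\cdot,t)\|_{L^\infty(V)}\to 0$ as $t\to+\infty$. (ii) If $u_0\in\mathscr{S}$, then $T_{\max}(u_0)<+\infty$.
   Context: $G=(V,E,\mu,\omega)$ is a finite connected graph with positive measure $\mu:V\to(0,\infty)$ and positive symmetric edge weights $\omega_{xy}=\omega_{yx}>0$; $y\sim x$ means that $x,y$ are joined by an edge. The $\mu$-Laplacian is $\Delta u(x)=\frac{1}{\mu(x)}\sum_{y\sim x}\omega_{xy}(u(y)-u(x))$, $|\nabla u|^2(x)=\frac{1}{2\mu(x)}\sum_{y\sim x}\omega_{xy}(u(y)-u(x))^2$, and $\int_V f\,d\mu=\sum_{x\in V}\mu(x)f(x)$. Since $V$ is finite, $W^{1,2}(V)$ is the space of all functions $V\to\mathbb{R}$; $\|f\|_{L^\infty(V)}=\max_V|f|$. Fixed data: $p>1$ and $a:V\to\mathbb{R}$ with $a\ge 0$ on $V$ and $a\not\equiv 0$. Define $$J(u)=\frac12\int_V(|\nabla u|^2+au^2)d\mu-\frac{1}{p+1}\int_V|u|^{p+1}d\mu,\qquad N(u)=\int_V(|\nabla u|^2+au^2)d\mu-\int_V|u|^{p+1}d\mu,$$ $$\mathbf{r}=\inf\{J(u):u\in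 W^{1,2}(V)\setminus\{0\},\ N(u)=0\},$$ $$\mathscr{W}=\{u\in W^{1,2}(V):J(u)<\mathbf{r},\ N(u)>0\}\cup\{0\},\qquad \mathscr{S}=\{u\in W^{1,2}(V):J(u)<\mathbf{r},\ N(u)<0\}.$$ Solutions are $C^1$ in $t$ for each $x\in V$; $[0,T_{\max}(u_0))$ is the maximal interval of existence of the unique solution with initial value $u_0$. *)

theory Defs
  imports "HOL-Analysis.Analysis"
begin

text \<open>
  The vertex set \<open>V\<close> is the universe of a finite type \<open>'v\<close>, so that \<open>W\<^sup>1\<^sup>,\<^sup>2(V)\<close> is
  the whole function type \<open>'v \<Rightarrow> real\<close>.
\<close>

record 'v weighted_graph =
  adj :: "'v \<Rightarrow> 'v \<Rightarrow> bool"
  meas :: "'v \<Rightarrow> real"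
  weight :: "'v \<Rightarrow> 'v \<Rightarrow> real"

text \<open>
  The values of \<open>weight\<close> on non-adjacent pairs are irrelevant.  Loops are neither required nor
  excluded; they contribute zero to the Laplacian and to the gradient.
\<close>

locale connected_weighted_graph =
  fixes G :: "'v::finite weighted_graph"
  assumes adj_sym: "adj G x y \<Longrightarrow> adj G y x"
    and connected: "(adj G)\<^sup>*\<^sup>* x y"
    and meas_pos: "meas G x > 0"
    and weight_pos: "adj G x y \<Longrightarrow> weight G x y > 0"
    and weight_sym: "adj G x y \<Longrightarrow> weight G x y = weight G y x"

definition vertex_integral :: "'v::finite weighted_graph \<Rightarrow> ('v \<Rightarrow> real) \<Rightarrow> real" where
  "vertex_integral G f = (\<Sum>x\<in>UNIV. meas G x * f x)"

definition laplacian :: "'v::finite weighted_graph \<Rightarrow> ('v \<Rightarrow> real) \<Rightarrow> 'v \<Rightarrow> real" where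
  "laplacian G u x = 1 / meas G x * (\<Sum>y | adj G x y. weight G x y * (u y - u x))"

definition grad_sq :: "'v::finite weighted_graph \<Rightarrow> ('v \<Rightarrow> real) \<Rightarrow> 'v \<Rightarrow> real" where
  "grad_sq G u x = 1 / (2 * meas G x) * (\<Sum>y | adj G x y. weight G x y * (u y - u x)\<^sup>2)"

definition sup_norm :: "('v::finite \<Rightarrow> real) \<Rightarrow> real" where
  "sup_norm f = Max (range (\<lambda>x. \<bar>f x\<bar>))"

definition energy :: "'v::finite weighted_graph \<Rightarrow> real \<Rightarrow> ('v \<Rightarrow> real) \<Rightarrow> ('v \<Rightarrow> real) \<Rightarrow> real" where
  "energy G p a u =
     1 / 2 * vertex_integral G (\<lambda>x. grad_sq G u x + a x * (u x)\<^sup>2)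
     - 1 / (p + 1) * vertex_integral G (\<lambda>x. \<bar>u x\<bar> powr (p + 1))"

definition nehari :: "'v::finite weighted_graph \<Rightarrow> real \<Rightarrow> ('v \<Rightarrow> real) \<Rightarrow> ('v \<Rightarrow> real) \<Rightarrow> real" where
  "nehari G p a u =
     vertex_integral G (\<lambda>x. grad_sq G u x + a x * (u x)\<^sup>2)
     - vertex_integral G (\<lambda>x. \<bar>u x\<bar> powr (p + 1))"

text \<open>
  For \<open>p > 1\<close>, \<open>a \<ge> 0\<close> and \<open>a\<close> not identically zero on a connected graph, the set below is
  nonempty and bounded below by \<open>0\<close>, so the infimum in the reals is the actual one.
\<close>

definition ground_level :: "'v::finite weighted_graph \<Rightarrow> real \<Rightarrow> ('v \<Rightarrow> real) \<Rightarrow> real" where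
  "ground_level G p a = Inf {energy G p a u | u. u \<noteq> (\<lambda>x. 0) \<and> nehari G p a u = 0}"

definition stable_set :: "'v::finite weighted_graph \<Rightarrow> real \<Rightarrow> ('v \<Rightarrow> real) \<Rightarrow> ('v \<Rightarrow> real) set" where
  "stable_set G p a =
     {u. energy G p a u < ground_level G p a \<and> nehari G p a u > 0} \<union> {\<lambda>x. 0}"

definition unstable_set :: "'v::finite weighted_graph \<Rightarrow> real \<Rightarrow> ('v \<Rightarrow> real) \<Rightarrow> ('v \<Rightarrow> real) set" where
  "unstable_set G p a = {u. energy G p a u < ground_level G p a \<and> nehari G p a u < 0}"

definition time_interval :: "ereal \<Rightarrow> real set" where
  "time_interval T = {t. 0 \<le> t \<and> ereal t < T}"

text \<open>
  \<open>solves G p a u0 T u\<close>: \<open>u\<close> (written \<open>u t x\<close>, time first) is a solution on \<open>[0, T)\<close>, \<open>0 < T \<le> \<infinity>\<close>,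
  with \<open>v\<close> the time derivative at \<open>x\<close> (one-sided at \<open>t = 0\<close>).  The values of \<open>u\<close>
  outside \<open>[0, T)\<close> are unconstrained.
\<close>

definition solves ::
  "'v::finite weighted_graph \<Rightarrow> real \<Rightarrow> ('v \<Rightarrow> real) \<Rightarrow> ('v \<Rightarrow> real) \<Rightarrow> ereal \<Rightarrow>
    (real \<Rightarrow> 'v \<Rightarrow> real) \<Rightarrow> bool" where
  "solves G p a u0 T u \<longleftrightarrow>
     0 < T \<and> (\<forall>x. u 0 x = u0 x) \<and>
     (\<forall>x. \<exists>v. continuous_on (time_interval T) v \<and>
        (\<forall>t\<in>time_interval T.
           ((\<lambda>s. u s x) has_real_derivative v t) (at t within time_interval T)) \<and>
        (\<forall>t\<in>time_interval T. 0 < t \<longrightarrow>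
           v t = laplacian G (u t) x - a x * u t x + \<bar>u t x\<bar> powr (p - 1) * u t x))"

definition T_max :: "'v::finite weighted_graph \<Rightarrow> real \<Rightarrow> ('v \<Rightarrow> real) \<Rightarrow> ('v \<Rightarrow> real) \<Rightarrow> ereal" where
  "T_max G p a u0 = Sup {T. \<exists>u. solves G p a u0 T u}"

end

theory Submission
  imports Defs
begin

text \<open>
  Write \<open>J\<close> for the energy, \<open>N\<close> for the Nehari functional, \<open>r\<close> for the ground level, and regard a
  function on \<open>V\<close> as a vector in \<open>real ^ 'v\<close>, so that the equation becomes an ordinary differential
  equation \<open>w' = field w\<close> in a finite-dimensional space.  This equation is the gradient flow of \<open>J\<close> for the
  inner product weighted by \<open>\<mu>\<close>: along a solution \<open>J(w)' = - \<integral> (w')\<^sup>2\<close>, so \<open>J\<close> does not increase, and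
  \<open>(\<integral> w\<^sup>2)' = - 2 N(w)\<close>.  Both identities rest on Green's formula for the graph Laplacian.

  The Dirichlet form \<open>\<integral> \<bar>\<nabla>w\<bar>\<^sup>2 + a w\<^sup>2\<close> is positive definite, because the graph is connected and \<open>a\<close> is
  nonnegative and not identically zero.  It is homogeneous of degree \<open>2\<close>, whereas \<open>\<integral> \<bar>w\<bar>\<^sup>p\<^sup>+\<^sup>1\<close> has the larger
  degree \<open>p + 1\<close>; hence \<open>N > 0\<close> on a punctured ball around \<open>0\<close>, and \<open>r > 0\<close>.  In the sublevel set
  \<open>{J < r}\<close> the equation \<open>N = 0\<close> has only the solution \<open>0\<close>, so this set splits into two disjoint
  relatively open parts, the stable and the unstable set (\<open>sublevel_connected_cases\<close>).  A trajectory that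
  starts in \<open>{J < r}\<close> is a connected subset of it, and so it never leaves the part in which it starts
  (\<open>flow_invariant\<close>).  A trajectory may
  reach \<open>0\<close>, where \<open>N\<close> vanishes as well, but a whole neighbourhood of \<open>0\<close> in \<open>{J < r}\<close> belongs to the stable set.

  The stable set is bounded, since \<open>J\<close> dominates the Dirichlet form where \<open>N \<ge> 0\<close>.  If the nonlinearity is
  truncated beyond this bound, the field becomes globally Lipschitz and a contraction argument yields a
  solution for all times; by invariance it never reaches the truncation level and therefore
  solves the original equation (\<open>stable_global_flow\<close>).  For the decay, \<open>\<integral> w\<^sup>2\<close> decreases, and as long as it stays
  above some \<open>e > 0\<close> the trajectory lies in a compact set on which \<open>N\<close> has a positive minimum, so that
  \<open>\<integral> w\<^sup>2\<close> would fall to \<open>0\<close> in finite time.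

  On the unstable set, a compactness argument for bounded \<open>w\<close> and the
  identity \<open>N = 2 J - (p - 1) / (p + 1) \<integral> \<bar>w\<bar>\<^sup>p\<^sup>+\<^sup>1\<close> for large \<open>w\<close> give \<open>N(w) \<le> - \<kappa> \<bar>w\<bar>\<^sup>p\<^sup>+\<^sup>1\<close> along the
  trajectory (\<open>unstable_N_bound\<close>).  So \<open>m = \<integral> w\<^sup>2\<close> satisfies \<open>m' \<ge> const m\<^sup>\<gamma>\<close> with \<open>\<gamma> = (p + 1) / 2 > 1\<close>, which is
  impossible on an infinite time interval (\<open>superlinear_growth_blows_up\<close>).
\<close>

section \<open>Powers of absolute values and homogeneous functions\<close>

text \<open>
  The right-hand side is \<open>r \<bar>x\<bar>\<^sup>r\<^sup>-\<^sup>1 sgn x\<close>.  The case \<open>x = 0\<close> uses \<open>r > 1\<close>: the difference quotient is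
  \<open>\<bar>h\<bar>\<^sup>r\<^sup>-\<^sup>1\<close> up to sign.
\<close>

lemma abs_powr_has_real_derivative:
  fixes r x :: real
  assumes "r > 1"
  shows "((\<lambda>s. \<bar>s\<bar> powr r) has_real_derivative r * (\<bar>x\<bar> powr (r - 2) * x)) (at x)"
proof (cases "x = 0")
  case True
  have "((\<lambda>h::real. \<bar>h\<bar> powr (r - 1)) \<longlongrightarrow> \<bar>0\<bar> powr (r - 1)) (at 0)"
    using assms by (intro tendsto_powr' tendsto_intros) auto
  then have "((\<lambda>h::real. \<bar>h\<bar> powr (r - 1)) \<longlongrightarrow> 0) (at 0)"
    by simp
  moreover have "\<forall>\<^sub>F h in at (0::real). \<bar>h\<bar> powr (r - 1) = \<bar>\<bar>h\<bar> powr r / h\<bar>"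
    by (auto simp: eventually_at_filter powr_diff)
  ultimately have "((\<lambda>h::real. \<bar>\<bar>h\<bar> powr r / h\<bar>) \<longlongrightarrow> 0) (at 0)"
    by (rule Lim_transform_eventually)
  then have "((\<lambda>h::real. \<bar>h\<bar> powr r / h) \<longlongrightarrow> 0) (at 0)"
    by (rule tendsto_rabs_zero_cancel)
  then show ?thesis
    using True by (simp add: has_field_derivative_iff)
next
  case False
  then consider "x > 0" | "x < 0" by linarith
  then show ?thesis
  proof cases
    case 1
    have "((\<lambda>s. s powr r) has_real_derivative r * x powr (r - 1)) (at x)"
      using 1 by (auto intro!: derivative_eq_intros)
    moreover have "\<forall>\<^sub>F s in nhds x. \<bar>s\<bar> powr r = s powr r"
      using eventually_nhds_in_open[of "{0<..}" x] 1 by (auto elim!: eventually_mono)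
    moreover have "x powr (r - 1) = x powr (r - 2) * x"
      using 1 powr_add[of x "r - 2" 1] by simp
    ultimately show ?thesis
      using 1 by (simp add: DERIV_cong_ev)
  next
    case 2
    have "((\<lambda>s. (- s) powr r) has_real_derivative r * (- x) powr (r - 1) * (-1)) (at x)"
      using 2 by (auto intro!: derivative_eq_intros)
    moreover have "\<forall>\<^sub>F s in nhds x. \<bar>s\<bar> powr r = (- s) powr r"
      using eventually_nhds_in_open[of "{..<0}" x] 2 by (auto elim!: eventually_mono)
    moreover have "(- x) powr (r - 1) = (- x) powr (r - 2) * (- x)"
      using 2 powr_add[of "- x" "r - 2" 1] by simp
    ultimately show ?thesis
      using 2 by (simp add: DERIV_cong_ev)
  qed
qed

lemma powr_difference_le:
  fixes p K :: real
  assumes "p > 1" "0 \<le> s" "s \<le> t" "t \<le> K"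
  shows "t powr p - s powr p \<le> p * K powr (p - 1) * (t - s)"
proof (cases "s = t")
  case False
  then have "s < t" using assms by simp
  have c: "continuous_on {s..t} (\<lambda>x. x powr p)"
    using assms by (intro continuous_on_powr') (auto intro: continuous_intros)
  have d: "((\<lambda>x. x powr p) has_real_derivative p * x powr (p - 1)) (at x)" if "s < x" "x < t" for x
    using that assms by (auto intro!: derivative_eq_intros)
  obtain l z where "s < z" "z < t" "((\<lambda>x. x powr p) has_real_derivative l) (at z)"
      "t powr p - s powr p = (t - s) * l"
    using MVT[OF \<open>s < t\<close> c] d real_differentiable_def by metis
  moreover from this have "l = p * z powr (p - 1)"
    using d DERIV_unique by blast
  moreover have "z powr (p - 1) \<le> K powr (p - 1)"
    using \<open>s < z\<close> \<open>z < t\<close> assms by (intro powr_mono2) auto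
  ultimately show ?thesis
    using assms \<open>s < t\<close>
    by (metis less_eq_real_def mult.commute mult_left_mono diff_ge_0_iff_ge less_trans zero_less_one)
qed simp

text \<open>
  The function is odd and agrees with the \<open>p\<close>-th power on \<open>[0, \<infinity>)\<close>, so two points of equal sign reduce to
  \<open>powr_difference_le\<close>, and two points of opposite sign are compared through \<open>0\<close>.
\<close>

lemma signed_powr_lipschitz:
  fixes p K :: real
  assumes p: "p > 1"
  shows "(p * K powr (p - 1))-lipschitz_on {-K..K} (\<lambda>s. \<bar>s\<bar> powr (p - 1) * s)"
proof (rule lipschitz_on_leI)
  fix s t :: real
  assume st: "s \<in> {-K..K}" "t \<in> {-K..K}" "s \<le> t"
  have pos: "\<bar>x\<bar> powr (p - 1) * x = x powr p" if "x \<ge> 0" for x :: real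
    using that powr_add[of x "p - 1" 1] by (cases "x = 0") auto
  have neg: "\<bar>x\<bar> powr (p - 1) * x = - ((- x) powr p)" if "x \<le> 0" for x :: real
    using that pos[of "- x"] by simp
  note aux = powr_difference_le[OF p]
  have mono: "x powr p \<le> y powr p" if "0 \<le> x" "x \<le> y" for x y :: real
    using that p by (intro powr_mono2) auto
  consider "0 \<le> s" | "s < 0" "0 \<le> t" | "t < 0" by linarith
  then have "\<bar>t\<bar> powr (p - 1) * t - \<bar>s\<bar> powr (p - 1) * s \<in> {0..p * K powr (p - 1) * (t - s)}"
  proof cases
    case 1
    then show ?thesis using st aux[of s t K] mono[of s t] pos[of s] pos[of t] by auto
  next
    case 2
    then show ?thesis
      using st aux[of 0 t K] aux[of 0 "- s" K] p pos[of t] neg[of s]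
      by (simp add: right_diff_distrib add_nonneg_nonneg)
  next
    case 3
    then show ?thesis using st aux[of "- t" "- s" K] mono[of "- t" "- s"] neg[of s] neg[of t] by auto
  qed
  then show "dist (\<bar>s\<bar> powr (p - 1) * s) (\<bar>t\<bar> powr (p - 1) * t) \<le> p * K powr (p - 1) * dist s t"
    using st by (simp add: dist_real_def)
qed (use p in auto)

text \<open>
  The constants are the minimum and the maximum of \<open>F\<close> on the compact unit sphere.
\<close>

lemma homogeneous_bounds:
  fixes F :: "'b::euclidean_space \<Rightarrow> real"
  assumes cont: "continuous_on UNIV F"
    and pos: "\<And>w. w \<noteq> 0 \<Longrightarrow> F w > 0"
    and hom: "\<And>s w. s > 0 \<Longrightarrow> F (s *\<^sub>R w) = s powr k * F w"
    and zero: "F 0 = 0"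
  obtains c C where "c > 0" "C > 0" "\<And>w. c * norm w powr k \<le> F w" "\<And>w. F w \<le> C * norm w powr k"
proof -
  have ne: "sphere (0::'b) 1 \<noteq> {}"
    using norm_Basis SOME_Basis by (force simp: sphere_def)
  have c: "continuous_on (sphere 0 1) F"
    using cont continuous_on_subset by blast
  obtain m where m: "m \<in> sphere 0 1" "\<And>w. w \<in> sphere 0 1 \<Longrightarrow> F m \<le> F w"
    using continuous_attains_inf[OF compact_sphere ne c] by blast
  obtain M where M: "M \<in> sphere 0 1" "\<And>w. w \<in> sphere 0 1 \<Longrightarrow> F w \<le> F M"
    using continuous_attains_sup[OF compact_sphere ne c] by blast
  have "F m * norm w powr k \<le> F w \<and> F w \<le> F M * norm w powr k" for w
  proof (cases "w = 0")
    case False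
    then have "w /\<^sub>R norm w \<in> sphere 0 1"
      by simp
    moreover have "F w = norm w powr k * F (w /\<^sub>R norm w)"
      using hom[of "norm w" "w /\<^sub>R norm w"] False by simp
    ultimately show ?thesis
      using m(2) M(2) by (metis mult.commute mult_right_mono powr_ge_zero)
  qed (simp add: zero)
  moreover have "m \<noteq> 0" "M \<noteq> 0"
    using m(1) M(1) by auto
  ultimately show thesis
    using that pos by blast
qed

section \<open>Ordinary differential equations\<close>

lemma vec_nth_vec_lambda [simp]: "($) (vec_lambda f) = f"
  by (simp add: fun_eq_iff)

lemma has_vector_derivative_cart:
  fixes w :: "real \<Rightarrow> real ^ 'n"
  shows "(w has_vector_derivative d) (at t within S) \<longleftrightarrow>
    (\<forall>x. ((\<lambda>t. w t $ x) has_real_derivative d $ x) (at t within S))"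
proof -
  have "(\<lambda>h. h * d $ x) = (*) (d $ x)" for x
    by (simp add: fun_eq_iff)
  then show ?thesis
    unfolding has_vector_derivative_def has_field_derivative_def
    by (subst has_derivative_componentwise_within) (auto simp: Basis_vec_def inner_axis)
qed

lemma time_interval_initial_segment:
  "t \<in> time_interval T \<Longrightarrow> {0..t} \<subseteq> time_interval T"
  by (auto simp: time_interval_def) (meson ereal_less_eq(3) le_less_trans)

lemma time_interval_infinity [simp]: "time_interval \<infinity> = {0..}"
  by (auto simp: time_interval_def)

text \<open>
  This turns the one-sided derivatives of the solution concept into two-sided ones; only \<open>t = 0\<close> is a
  boundary point of \<open>[0, T)\<close>.
\<close>

lemma at_within_time_interval:
  assumes "t \<in> time_interval T" "t > 0"
  shows "at t within time_interval T = at t"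
proof (rule at_within_interior, rule interiorI)
  show "open {s. 0 < s \<and> ereal s < T}"
    by (intro open_Collect_conj open_Collect_less continuous_intros continuous_on_ereal)
qed (use assms in \<open>auto simp: time_interval_def\<close>)

text \<open>
  The basic estimate in Bielecki's weighted norm \<open>sup\<^sub>t e\<^sup>-\<^sup>2\<^sup>L\<^sup>t \<bar>f(t)\<bar>\<close>: integration in time gains the factor
  \<open>1 / (2 L)\<close>, uniformly in \<open>t\<close>.
\<close>

lemma exp_weighted_integral_bound:
  fixes f :: "real \<Rightarrow> 'b::banach"
  assumes L: "L > 0" and t: "t \<ge> 0" and cont: "continuous_on {0..t} f"
    and bound: "\<And>s. s \<in> {0..t} \<Longrightarrow> norm (f s) \<le> C * exp (2 * L * s)"
    and C: "C \<ge> 0"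
  shows "norm (exp (- (2 * L * t)) *\<^sub>R integral {0..t} f) \<le> C / (2 * L)"
proof -
  have "((\<lambda>s. C * exp (2 * L * s)) has_integral
      (C / (2 * L) * exp (2 * L * t) - C / (2 * L) * exp (2 * L * 0))) {0..t}"
    using t L
    by (intro fundamental_theorem_of_calculus)
      (auto intro!: derivative_eq_intros simp: has_real_derivative_iff_has_vector_derivative[symmetric])
  then have "norm (integral {0..t} f) \<le> C / (2 * L) * exp (2 * L * t) - C / (2 * L) * exp (2 * L * 0)"
    using integral_norm_bound_integral[OF integrable_continuous_real[OF cont] _ bound]
    by (metis has_integral_integrable integral_unique)
  also have "\<dots> \<le> C / (2 * L) * exp (2 * L * t)"
    using C L by simp
  finally show ?thesis
    using L by (simp add: exp_minus field_simps)
qed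

lemma integral_atLeast_has_vector_derivative:
  fixes f :: "real \<Rightarrow> 'b::banach"
  assumes "continuous_on {0..} f" "t \<ge> 0"
  shows "((\<lambda>t. integral {0..t} f) has_vector_derivative f t) (at t within {0..})"
proof -
  have "((\<lambda>t. integral {0..t} f) has_vector_derivative f t) (at t within {0..t + 1})"
    using assms by (intro integral_has_vector_derivative) (auto elim: continuous_on_subset)
  moreover have "at t within {0..} = at t within {0..t + 1}"
    by (rule at_within_nhd[of _ "{..<t + 1}"]) auto
  ultimately show ?thesis
    by simp
qed

text \<open>
  With \<open>M > L\<close>, the Picard map is, in the weighted norm \<open>sup\<^sub>t e\<^sup>-\<^sup>2\<^sup>M\<^sup>t \<bar>w(t)\<bar>\<close>, a contraction on the whole half-line at once, with
  factor \<open>1/2\<close>, so no local solutions have to be glued together.  The fixed point is sought as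
  \<open>v(t) = e\<^sup>-\<^sup>2\<^sup>M\<^sup>t w(t)\<close> in the complete space of bounded continuous functions.
\<close>

theorem lipschitz_field_global_solution:
  fixes F :: "'b::banach \<Rightarrow> 'b" and w0 :: 'b
  assumes lip: "L-lipschitz_on UNIV F"
  obtains w where "w 0 = w0"
    "\<And>t. t \<ge> 0 \<Longrightarrow> (w has_vector_derivative F (w t)) (at t within {0..})"
proof -
  \<comment> \<open>The constant \<open>L\<close> may be \<open>0\<close>, but the weight has to grow.\<close>
  define M where "M = L + 1"
  have M: "M > 0" "L \<le> M"
    using lip by (auto simp: M_def lipschitz_on_def)
  have LipM: "norm (F x - F y) \<le> M * norm (x - y)" for x y
    using lipschitz_on_normD[OF lip, of x y] M(2)
    by (meson UNIV_I mult_right_mono norm_ge_zero order_trans)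
  have contF: "continuous_on S F" for S
    using lipschitz_on_continuous_on[OF lip] continuous_on_subset by blast
  define f where "f v s = F (exp (2 * M * s) *\<^sub>R apply_bcontfun v s)" for v s
  \<comment> \<open>The functions live on all of \<open>\<real>\<close>; freezing the time at \<open>0\<close> for negative \<open>t\<close> keeps
    \<open>\<Phi> v\<close> bounded and continuous there.\<close>
  define \<Phi> where "\<Phi> v t = exp (- (2 * M * max 0 t)) *\<^sub>R (w0 + integral {0..max 0 t} (f v))" for v t
  have contf: "continuous_on S (f v)" for v S
    unfolding f_def
    by (rule continuous_on_compose2[OF contF[of UNIV]]) (auto intro!: continuous_intros)
  have \<Phi>_bcont: "\<Phi> v \<in> bcontfun" for v
  proof (rule bcontfun_normI)
    have "continuous_on {0..} (\<lambda>t. integral {0..t} (f v))"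
      using integral_atLeast_has_vector_derivative[OF contf]
      by (meson atLeast_iff continuous_on_eq_continuous_within has_vector_derivative_continuous)
    then have "continuous_on UNIV (\<lambda>t. integral {0..max 0 t} (f v))"
      by (rule continuous_on_compose2) (auto intro!: continuous_intros)
    then show "continuous_on UNIV (\<Phi> v)"
      unfolding \<Phi>_def by (intro continuous_intros)
  next
    fix t :: real
    define \<tau> where "\<tau> = max 0 t"
    have \<tau>: "\<tau> \<ge> 0" by (simp add: \<tau>_def)
    have "norm (f v s) \<le> (norm (F 0) + M * norm v) * exp (2 * M * s)" if "s \<in> {0..\<tau>}" for s
    proof -
      have "norm (f v s) \<le> norm (F 0) + norm (f v s - F 0)"
        by (metis add.commute diff_add_cancel norm_triangle_ineq)
      also have "\<dots> \<le> norm (F 0) + M * (exp (2 * M * s) * norm (apply_bcontfun v s))"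
        using LipM[of "exp (2 * M * s) *\<^sub>R apply_bcontfun v s" 0] by (simp add: f_def)
      also have "\<dots> \<le> norm (F 0) * exp (2 * M * s) + M * (exp (2 * M * s) * norm v)"
        using that M norm_bounded[of v s] by (intro add_mono mult_left_mono) (auto intro: mult_right_le_one_le simp: mult_le_cancel_left1)
      finally show ?thesis by (simp add: algebra_simps)
    qed
    then have "norm (exp (- (2 * M * \<tau>)) *\<^sub>R integral {0..\<tau>} (f v)) \<le> (norm (F 0) + M * norm v) / (2 * M)"
      using M \<tau> by (intro exp_weighted_integral_bound contf) auto
    moreover have "norm (exp (- (2 * M * \<tau>)) *\<^sub>R w0) \<le> norm w0"
      using M \<tau> by (simp add: mult_left_le_one_le)
    ultimately show "norm (\<Phi> v t) \<le> norm w0 + (norm (F 0) + M * norm v) / (2 * M)"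
      unfolding \<Phi>_def \<tau>_def[symmetric] scaleR_add_right
      by (meson add_mono norm_triangle_ineq order_trans)
  qed
  have "dist (Bcontfun (\<Phi> v)) (Bcontfun (\<Phi> v')) \<le> 1 / 2 * dist v v'" for v v'
  proof (rule dist_bound)
    fix t :: real
    define \<tau> where "\<tau> = max 0 t"
    have \<tau>: "\<tau> \<ge> 0" by (simp add: \<tau>_def)
    have "norm (f v s - f v' s) \<le> (M * dist v v') * exp (2 * M * s)" for s
    proof -
      have "norm (f v s - f v' s) \<le> M * (exp (2 * M * s) * norm (apply_bcontfun v s - apply_bcontfun v' s))"
        using LipM[of "exp (2 * M * s) *\<^sub>R apply_bcontfun v s" "exp (2 * M * s) *\<^sub>R apply_bcontfun v' s"]
        by (simp add: f_def flip: scaleR_diff_right)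
      also have "\<dots> \<le> M * (exp (2 * M * s) * dist v v')"
        using M dist_bounded[of v s v'] by (intro mult_left_mono) (auto simp: dist_norm)
      finally show ?thesis by (simp add: algebra_simps)
    qed
    then have "norm (exp (- (2 * M * \<tau>)) *\<^sub>R integral {0..\<tau>} (\<lambda>s. f v s - f v' s)) \<le> (M * dist v v') / (2 * M)"
      using M \<tau> by (intro exp_weighted_integral_bound continuous_intros contf) auto
    moreover have "integral {0..\<tau>} (\<lambda>s. f v s - f v' s) = integral {0..\<tau>} (f v) - integral {0..\<tau>} (f v')"
      by (intro integral_diff integrable_continuous_real contf)
    ultimately show "dist (apply_bcontfun (Bcontfun (\<Phi> v)) t) (apply_bcontfun (Bcontfun (\<Phi> v')) t) \<le> 1 / 2 * dist v v'"
      using M by (simp add: Bcontfun_inverse[OF \<Phi>_bcont] dist_norm \<Phi>_def \<tau>_def[symmetric] flip: scaleR_diff_right)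
  qed
  then obtain v where v: "Bcontfun (\<Phi> v) = v"
    using banach_fix_type[of "1/2" "\<lambda>v. Bcontfun (\<Phi> v)"] by auto
  define w where "w t = exp (2 * M * t) *\<^sub>R apply_bcontfun v t" for t
  have w: "w t = w0 + integral {0..t} (f v)" if "t \<ge> 0" for t
  proof -
    have "apply_bcontfun v t = \<Phi> v t"
      by (metis v Bcontfun_inverse[OF \<Phi>_bcont])
    then show ?thesis
      using that by (simp add: w_def \<Phi>_def exp_minus)
  qed
  show thesis
  proof
    show "w 0 = w0"
      using w[of 0] by simp
    fix t :: real assume t: "t \<ge> 0"
    have "((\<lambda>t. w0 + integral {0..t} (f v)) has_vector_derivative f v t) (at t within {0..})"
      using has_vector_derivative_add[OF has_vector_derivative_const integral_atLeast_has_vector_derivative[OF contf t]] by simp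
    moreover have "f v t = F (w t)"
      by (simp add: f_def w_def)
    ultimately show "(w has_vector_derivative F (w t)) (at t within {0..})"
      using t w by (auto intro: has_vector_derivative_transform)
  qed
qed

text \<open>
  The function \<open>f\<^sup>1\<^sup>-\<^sup>\<gamma>\<close> would have to stay positive while it decreases at least at the constant rate \<open>\<kappa> (\<gamma> - 1)\<close>.
\<close>

lemma superlinear_growth_blows_up:
  fixes f :: "real \<Rightarrow> real"
  assumes "\<gamma> > 1" "\<kappa> > 0"
    and cont: "continuous_on {0..} f"
    and pos: "\<And>t. t \<ge> 0 \<Longrightarrow> f t > 0"
    and deriv: "\<And>t. t > 0 \<Longrightarrow> \<exists>d. (f has_real_derivative d) (at t) \<and> d \<ge> \<kappa> * f t powr \<gamma>"
  shows False
proof -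
  define h where "h t = f t powr (1 - \<gamma>) + \<kappa> * (\<gamma> - 1) * t" for t
  \<comment> \<open>By this time the decrease has used up the initial value \<open>f(0)\<^sup>1\<^sup>-\<^sup>\<gamma>\<close>.\<close>
  define t where "t = f 0 powr (1 - \<gamma>) / (\<kappa> * (\<gamma> - 1))"
  have t: "t > 0"
    using assms(1,2) pos[of 0] by (simp add: t_def)
  have "h 0 \<ge> h t"
  proof (rule DERIV_nonpos_imp_decreasing_open[of 0 t h])
    have "continuous_on {0..t} f"
      using cont by (rule continuous_on_subset) auto
    moreover have "f s \<noteq> 0" if "s \<in> {0..t}" for s
      using pos[of s] that by simp
    ultimately show "continuous_on {0..t} h"
      unfolding h_def by (intro continuous_intros) auto
  next
    fix s assume s: "0 < s" "s < t"
    obtain d where d: "(f has_real_derivative d) (at s)" "d \<ge> \<kappa> * f s powr \<gamma>"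
      using deriv[OF s(1)] by blast
    have fs: "f s > 0" using pos s by simp
    have "(h has_real_derivative (1 - \<gamma>) * f s powr (- \<gamma>) * d + \<kappa> * (\<gamma> - 1)) (at s)"
      using DERIV_add[OF DERIV_chain2[OF has_real_derivative_powr[OF fs, of "1 - \<gamma>"] d(1)]
          DERIV_cmult[OF DERIV_ident, of "\<kappa> * (\<gamma> - 1)"]]
      by (simp add: h_def[abs_def])
    moreover have "(\<gamma> - 1) * f s powr (- \<gamma>) * (\<kappa> * f s powr \<gamma>) \<le> (\<gamma> - 1) * f s powr (- \<gamma>) * d"
      using assms(1) d(2) by (intro mult_left_mono) auto
    then have "(1 - \<gamma>) * f s powr (- \<gamma>) * d + \<kappa> * (\<gamma> - 1) \<le> 0"
      using fs by (simp add: powr_minus algebra_simps)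
    ultimately show "\<exists>y. (h has_real_derivative y) (at s) \<and> y \<le> 0"
      by blast
  qed (use t in simp)
  moreover have "\<kappa> * (\<gamma> - 1) * t = f 0 powr (1 - \<gamma>)"
    using assms(1,2) by (simp add: t_def)
  ultimately have "f t powr (1 - \<gamma>) \<le> 0"
    by (simp add: h_def)
  then show False
    using pos[of t] t by simp
qed

section \<open>The Dirichlet form of a weighted graph\<close>

text \<open>
  Summation by parts: since the weights are symmetric, exchanging \<open>x\<close> and \<open>y\<close> shows that the terms with
  \<open>h y\<close> and those with \<open>h x\<close> contribute equally.
\<close>

lemma (in connected_weighted_graph) green_formula:
  "(\<Sum>x\<in>UNIV. \<Sum>y | adj G x y. weight G x y * ((f y - f x) * (h y - h x))) =
    - 2 * vertex_integral G (\<lambda>x. laplacian G f x * h x)"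
proof -
  \<comment> \<open>Weights extended by zero, so that both sums run over all of \<open>V\<close> and can be exchanged.\<close>
  define W where "W x y = (if adj G x y then weight G x y else 0)" for x y
  have W: "(\<Sum>y | adj G x y. weight G x y * k y) = (\<Sum>y\<in>UNIV. W x y * k y)" for x k
    unfolding W_def by (rule sum.mono_neutral_cong_left) auto
  have W_sym: "W x y = W y x" for x y
    using adj_sym weight_sym by (auto simp: W_def)
  have "(\<Sum>x\<in>UNIV. \<Sum>y\<in>UNIV. W x y * ((f y - f x) * h y)) =
      (\<Sum>x\<in>UNIV. \<Sum>y\<in>UNIV. W y x * ((f x - f y) * h x))"
    by (rule sum.swap)
  also have "\<dots> = (\<Sum>x\<in>UNIV. \<Sum>y\<in>UNIV. - (W x y * ((f y - f x) * h x)))"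
    by (intro sum.cong refl) (simp add: W_sym[of _ x for x] algebra_simps)
  finally have swap: "(\<Sum>x\<in>UNIV. \<Sum>y\<in>UNIV. W x y * ((f y - f x) * h y)) =
      - (\<Sum>x\<in>UNIV. \<Sum>y\<in>UNIV. W x y * ((f y - f x) * h x))"
    by (simp add: sum_negf)
  have "(\<Sum>x\<in>UNIV. \<Sum>y\<in>UNIV. W x y * ((f y - f x) * (h y - h x))) =
      (\<Sum>x\<in>UNIV. \<Sum>y\<in>UNIV. W x y * ((f y - f x) * h y)) -
      (\<Sum>x\<in>UNIV. \<Sum>y\<in>UNIV. W x y * ((f y - f x) * h x))"
    by (simp add: algebra_simps sum_subtractf sum.distrib)
  also have "\<dots> = - 2 * (\<Sum>x\<in>UNIV. \<Sum>y\<in>UNIV. W x y * ((f y - f x) * h x))"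
    by (simp add: swap)
  also have "(\<Sum>x\<in>UNIV. \<Sum>y\<in>UNIV. W x y * ((f y - f x) * h x)) =
      vertex_integral G (\<lambda>x. laplacian G f x * h x)"
    unfolding vertex_integral_def laplacian_def W
    using meas_pos[THEN less_imp_neq]
    by (intro sum.cong refl) (auto simp: sum_distrib_left sum_distrib_right mult_ac)
  finally show ?thesis
    by (simp add: W)
qed

lemma (in connected_weighted_graph) grad_sq_nonneg: "grad_sq G f x \<ge> 0"
  unfolding grad_sq_def using meas_pos[of x] weight_pos
  by (intro mult_nonneg_nonneg sum_nonneg) (auto intro: less_imp_le)

lemma (in connected_weighted_graph) vertex_integral_pos:
  assumes "\<And>x. f x \<ge> 0" "f z > 0"
  shows "vertex_integral G f > 0"
  unfolding vertex_integral_def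
  using assms meas_pos by (intro sum_pos2[of _ z]) (auto intro!: mult_nonneg_nonneg intro: less_imp_le)

locale potential_well = connected_weighted_graph G for G :: "'v::finite weighted_graph" +
  fixes p :: real and a :: "'v \<Rightarrow> real"
  assumes p_gt_1: "p > 1"
    and a_nonneg: "a x \<ge> 0"
    and a_nonzero: "\<exists>x. a x \<noteq> 0"
begin

definition dirichlet :: "real ^ 'v \<Rightarrow> real" where
  "dirichlet w = vertex_integral G (\<lambda>x. grad_sq G (($) w) x + a x * (w $ x)\<^sup>2)"

definition power_mass :: "real ^ 'v \<Rightarrow> real" where
  "power_mass w = vertex_integral G (\<lambda>x. \<bar>w $ x\<bar> powr (p + 1))"

definition mass :: "real ^ 'v \<Rightarrow> real" where
  "mass w = vertex_integral G (\<lambda>x. (w $ x)\<^sup>2)"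

abbreviation J :: "real ^ 'v \<Rightarrow> real" where
  "J w \<equiv> energy G p a (($) w)"

abbreviation N :: "real ^ 'v \<Rightarrow> real" where
  "N w \<equiv> nehari G p a (($) w)"

abbreviation ground :: real where
  "ground \<equiv> ground_level G p a"

lemma N_eq: "N w = dirichlet w - power_mass w"
  by (simp add: nehari_def dirichlet_def power_mass_def)

lemma J_eq: "J w = dirichlet w / 2 - power_mass w / (p + 1)"
  by (simp add: energy_def dirichlet_def power_mass_def)

text \<open>
  Where \<open>N \<ge> 0\<close>, the energy controls the Dirichlet form from above; on the Nehari manifold \<open>N = 0\<close> it is
  a positive multiple of it.
\<close>

lemma J_eq_N: "J w = (p - 1) / (2 * (p + 1)) * dirichlet w + N w / (p + 1)"
proof -
  have "(p - 1) / (2 * (p + 1)) + 1 / (p + 1) = 1 / 2"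
    using p_gt_1 by (simp add: divide_simps) (simp add: algebra_simps)
  then have "dirichlet w / 2 = ((p - 1) / (2 * (p + 1)) + 1 / (p + 1)) * dirichlet w"
    by simp
  then show ?thesis
    by (simp only: J_eq N_eq diff_divide_distrib distrib_right) simp
qed

lemma continuous_on_dirichlet: "continuous_on S dirichlet"
  unfolding dirichlet_def vertex_integral_def grad_sq_def
  by (intro continuous_intros)

lemma continuous_on_power_mass: "continuous_on S power_mass"
  unfolding power_mass_def vertex_integral_def
  using p_gt_1 by (intro continuous_intros continuous_on_powr') auto

lemma continuous_on_mass: "continuous_on S mass"
  unfolding mass_def vertex_integral_def
  by (intro continuous_intros)

lemma continuous_on_N: "continuous_on S N"
  unfolding N_eq by (intro continuous_intros continuous_on_dirichlet continuous_on_power_mass)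

lemma continuous_on_J: "continuous_on S J"
  unfolding J_eq using p_gt_1
  by (intro continuous_intros continuous_on_dirichlet continuous_on_power_mass) auto

lemma dirichlet_scaleR: "dirichlet (s *\<^sub>R w) = s\<^sup>2 * dirichlet w"
proof -
  have sums: "(\<Sum>y | adj G x y. weight G x y * (s\<^sup>2 * k y)) =
      s\<^sup>2 * (\<Sum>y | adj G x y. weight G x y * k y)" for x k
    by (simp add: sum_distrib_left mult.left_commute)
  have diff: "(s * w $ y - s * w $ x)\<^sup>2 = s\<^sup>2 * (w $ y - w $ x)\<^sup>2" for x y
    by (metis power_mult_distrib right_diff_distrib)
  have "grad_sq G (($) (s *\<^sub>R w)) x + a x * ((s *\<^sub>R w) $ x)\<^sup>2 =
      s\<^sup>2 * (grad_sq G (($) w) x + a x * (w $ x)\<^sup>2)" for x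
    by (simp add: grad_sq_def diff sums power_mult_distrib mult.left_commute distrib_left)
  then show ?thesis
    by (simp add: dirichlet_def vertex_integral_def sum_distrib_left mult.left_commute)
qed

lemma power_mass_scaleR: "s > 0 \<Longrightarrow> power_mass (s *\<^sub>R w) = s powr (p + 1) * power_mass w"
  unfolding power_mass_def vertex_integral_def sum_distrib_left
  by (intro sum.cong refl) (simp add: abs_mult powr_mult)

lemma mass_scaleR: "mass (s *\<^sub>R w) = s\<^sup>2 * mass w"
  unfolding mass_def vertex_integral_def sum_distrib_left
  by (intro sum.cong refl) (simp add: power_mult_distrib)

text \<open>
  If the form vanishes at \<open>w\<close>, then \<open>w\<close> is constant along edges, hence constant by connectedness, and the
  constant is \<open>0\<close> because of a vertex where \<open>a > 0\<close>.
\<close>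

lemma dirichlet_pos:
  assumes "w \<noteq> 0"
  shows "dirichlet w > 0"
proof (rule ccontr)
  have nonneg: "meas G x * (grad_sq G (($) w) x + a x * (w $ x)\<^sup>2) \<ge> 0" for x
    using meas_pos[of x] a_nonneg[of x] grad_sq_nonneg by simp
  assume "\<not> dirichlet w > 0"
  moreover have "dirichlet w \<ge> 0"
    unfolding dirichlet_def vertex_integral_def using nonneg by (rule sum_nonneg)
  ultimately have "dirichlet w = 0" by simp
  then have "meas G x * (grad_sq G (($) w) x + a x * (w $ x)\<^sup>2) = 0" for x
    unfolding dirichlet_def vertex_integral_def
    using nonneg sum_nonneg_eq_0_iff[of UNIV "\<lambda>x. meas G x * (grad_sq G (($) w) x + a x * (w $ x)\<^sup>2)"]
    by auto
  then have "grad_sq G (($) w) x + a x * (w $ x)\<^sup>2 = 0" for x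
    using meas_pos[of x] by (metis less_irrefl mult_eq_0_iff)
  then have zero: "grad_sq G (($) w) x = 0" "a x * (w $ x)\<^sup>2 = 0" for x
    using grad_sq_nonneg[of "($) w" x] a_nonneg[of x]
    by (smt (verit) mult_nonneg_nonneg zero_le_power2)+
  have edge: "w $ y = w $ x" if "adj G x y" for x y
  proof -
    have "(\<Sum>y | adj G x y. weight G x y * (w $ y - w $ x)\<^sup>2) = 0"
      using zero(1)[of x] meas_pos[of x] by (simp add: grad_sq_def)
    then have "\<forall>y\<in>{y. adj G x y}. weight G x y * (w $ y - w $ x)\<^sup>2 = 0"
      by (subst (asm) sum_nonneg_eq_0_iff) (auto intro!: mult_nonneg_nonneg intro: less_imp_le weight_pos)
    then show ?thesis
      using that weight_pos[OF that] by auto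
  qed
  obtain x0 where "a x0 \<noteq> 0"
    using a_nonzero by blast
  then have x0: "w $ x0 = 0"
    using zero(2)[of x0] by simp
  have "w $ y = 0" for y
    using connected[of x0 y] by (induction rule: rtranclp_induct) (auto simp: x0 edge)
  then show False
    using assms by (simp add: vec_eq_iff)
qed

lemma power_mass_pos: "w \<noteq> 0 \<Longrightarrow> power_mass w > 0"
  unfolding power_mass_def vec_eq_iff by (auto intro: vertex_integral_pos)

lemma mass_pos: "w \<noteq> 0 \<Longrightarrow> mass w > 0"
  unfolding mass_def vec_eq_iff by (auto intro: vertex_integral_pos)

lemma forms_at_zero: "dirichlet 0 = 0" "power_mass 0 = 0" "mass 0 = 0"
  using p_gt_1
  by (simp_all add: dirichlet_def power_mass_def mass_def vertex_integral_def grad_sq_def)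

section \<open>The potential well\<close>

lemma dirichlet_lower:
  obtains c where "c > 0" "\<And>w. c * (norm w)\<^sup>2 \<le> dirichlet w"
proof (rule homogeneous_bounds[of dirichlet 2])
  show "dirichlet (s *\<^sub>R w) = s powr 2 * dirichlet w" if "s > 0" for s w
    using that by (simp add: dirichlet_scaleR)
qed (use that in \<open>auto simp: continuous_on_dirichlet dirichlet_pos forms_at_zero\<close>)

lemma mass_lower:
  obtains c where "c > 0" "\<And>w. c * (norm w)\<^sup>2 \<le> mass w"
proof (rule homogeneous_bounds[of mass 2])
  show "mass (s *\<^sub>R w) = s powr 2 * mass w" if "s > 0" for s w
    using that by (simp add: mass_scaleR)
qed (use that in \<open>auto simp: continuous_on_mass mass_pos forms_at_zero\<close>)

lemma mass_upper:
  obtains C where "C > 0" "\<And>w. mass w \<le> C * (norm w)\<^sup>2"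
proof (rule homogeneous_bounds[of mass 2])
  show "mass (s *\<^sub>R w) = s powr 2 * mass w" if "s > 0" for s w
    using that by (simp add: mass_scaleR)
qed (use that in \<open>auto simp: continuous_on_mass mass_pos forms_at_zero\<close>)

lemma power_mass_lower:
  obtains c where "c > 0" "\<And>w. c * norm w powr (p + 1) \<le> power_mass w"
  by (rule homogeneous_bounds[of power_mass "p + 1"])
    (use that in \<open>auto simp: continuous_on_power_mass power_mass_pos power_mass_scaleR forms_at_zero\<close>)

lemma power_mass_upper:
  obtains C where "C > 0" "\<And>w. power_mass w \<le> C * norm w powr (p + 1)"
  by (rule homogeneous_bounds[of power_mass "p + 1"])
    (use that in \<open>auto simp: continuous_on_power_mass power_mass_pos power_mass_scaleR forms_at_zero\<close>)

lemma mass_nonneg: "mass w \<ge> 0"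
  using mass_pos[of w] forms_at_zero by (cases "w = 0") auto

text \<open>
  The Dirichlet form is at least of order \<open>\<bar>w\<bar>\<^sup>2\<close>, and the subtracted term has the higher order \<open>\<bar>w\<bar>\<^sup>p\<^sup>+\<^sup>1\<close>.
\<close>

lemma N_pos_near_0:
  obtains \<delta> where "\<delta> > 0" "\<And>w. norm w < \<delta> \<Longrightarrow> w \<noteq> 0 \<Longrightarrow> N w > 0"
proof -
  obtain c where c: "c > 0" "\<And>w. c * (norm w)\<^sup>2 \<le> dirichlet w"
    using dirichlet_lower by blast
  obtain C where C: "C > 0" "\<And>w. power_mass w \<le> C * norm w powr (p + 1)"
    using power_mass_upper by blast
  \<comment> \<open>The two bounds balance, \<open>C \<delta>\<^sup>p\<^sup>+\<^sup>1 = c \<delta>\<^sup>2\<close>, at this radius.\<close>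
  define \<delta> where "\<delta> = (c / C) powr (1 / (p - 1))"
  show thesis
  proof
    show "\<delta> > 0"
      using c C by (simp add: \<delta>_def)
    fix w :: "real ^ 'v" assume w: "norm w < \<delta>" "w \<noteq> 0"
    have "norm w powr (p - 1) < \<delta> powr (p - 1)"
      using w p_gt_1 by (intro powr_less_mono2) auto
    also have "\<dots> = c / C"
      using c C p_gt_1 by (simp add: \<delta>_def powr_powr)
    finally have "C * norm w powr (p - 1) < c"
      using C by (simp add: field_simps)
    moreover have "norm w powr (p + 1) = norm w powr (p - 1) * (norm w)\<^sup>2"
      using w powr_add[of "norm w" "p - 1" 2] by (simp add: add.commute)
    ultimately have "C * norm w powr (p + 1) < c * (norm w)\<^sup>2"
      using w by simp
    then show "N w > 0"
      using c(2)[of w] C(2)[of w] by (simp add: N_eq)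
  qed
qed

text \<open>
  Every ray from the origin meets the Nehari manifold; so the infimum that defines the ground level
  is taken over a nonempty set.
\<close>

lemma nehari_scaling:
  assumes "w \<noteq> 0"
  obtains s where "s > 0" "N (s *\<^sub>R w) = 0"
proof -
  define q where "q = dirichlet w / power_mass w"
  have q: "q > 0"
    using assms by (simp add: q_def dirichlet_pos power_mass_pos)
  define s where "s = q powr (1 / (p - 1))"
  have s: "s > 0" using q by (simp add: s_def)
  have "s powr (p + 1) = s powr (p - 1) * s\<^sup>2"
    using s powr_add[of s "p - 1" 2] by (simp add: add.commute)
  also have "s powr (p - 1) = q"
    using q p_gt_1 by (simp add: s_def powr_powr)
  finally have "N (s *\<^sub>R w) = 0"
    using power_mass_pos[OF assms]
    by (simp add: N_eq dirichlet_scaleR power_mass_scaleR[OF s] q_def)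
  then show thesis
    using s that by blast
qed

lemma nonzero_iff_nth_nonzero: "w \<noteq> 0 \<longleftrightarrow> ($) w \<noteq> (\<lambda>x. 0)"
  by (auto simp: vec_eq_iff fun_eq_iff)

lemma ground_level_set:
  "{energy G p a u | u. u \<noteq> (\<lambda>x. 0) \<and> nehari G p a u = 0} = {J w | w. w \<noteq> 0 \<and> N w = 0}"
    (is "?A = ?B")
proof
  show "?A \<subseteq> ?B"
  proof clarify
    fix u :: "'v \<Rightarrow> real"
    assume u: "u \<noteq> (\<lambda>x. 0)" "nehari G p a u = 0"
    then show "\<exists>w. energy G p a u = J w \<and> w \<noteq> 0 \<and> N w = 0"
      by (intro exI[of _ "vec_lambda u"]) (auto simp: nonzero_iff_nth_nonzero)
  qed
  show "?B \<subseteq> ?A"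
    using nonzero_iff_nth_nonzero by blast
qed

lemma ground_le_J:
  assumes "w \<noteq> 0" "N w = 0"
  shows "ground \<le> J w"
  unfolding ground_level_def ground_level_set
proof (rule cInf_lower)
  show "bdd_below {J w |w. w \<noteq> 0 \<and> N w = 0}"
    unfolding bdd_below_def
    using dirichlet_pos p_gt_1 by (intro exI[of _ 0]) (fastforce simp: J_eq_N)
qed (use assms in blast)

text \<open>
  The Nehari manifold keeps a positive distance from \<open>0\<close>, and on it \<open>J\<close> is a positive multiple of the
  Dirichlet form.
\<close>

lemma ground_pos: "ground > 0"
proof -
  obtain \<delta> where \<delta>: "\<delta> > 0" "\<And>w. norm w < \<delta> \<Longrightarrow> w \<noteq> 0 \<Longrightarrow> N w > 0"
    using N_pos_near_0 by blast
  obtain c where c: "c > 0" "\<And>w. c * (norm w)\<^sup>2 \<le> dirichlet w"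
    using dirichlet_lower by blast
  define b where "b = (p - 1) / (2 * (p + 1)) * (c * \<delta>\<^sup>2)"
  have "b \<le> ground"
    unfolding ground_level_def ground_level_set
  proof (rule cInf_greatest)
    obtain s where s: "s > 0" "N (s *\<^sub>R (\<chi> x. 1)) = 0"
      using nehari_scaling[of "\<chi> x. 1"] by (auto simp: vec_eq_iff)
    then have "s *\<^sub>R (\<chi> x. 1) \<noteq> (0 :: real ^ 'v)"
      by (simp add: vec_eq_iff)
    then show "{J w |w. w \<noteq> 0 \<and> N w = 0} \<noteq> {}"
      using s by blast
  next
    fix j assume "j \<in> {J w |w. w \<noteq> 0 \<and> N w = 0}"
    then obtain w where w: "j = J w" "w \<noteq> 0" "N w = 0" by blast
    have "\<delta> \<le> norm w"
      using \<delta>(2)[of w] w by force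
    then have "c * \<delta>\<^sup>2 \<le> c * (norm w)\<^sup>2"
      using c \<delta> by simp
    also have "\<dots> \<le> dirichlet w"
      by (rule c)
    finally have "b \<le> (p - 1) / (2 * (p + 1)) * dirichlet w"
      unfolding b_def using p_gt_1 by (intro mult_left_mono) auto
    then show "b \<le> j"
      using w by (simp add: J_eq_N)
  qed
  moreover have "b > 0"
    using p_gt_1 c \<delta> by (simp add: b_def)
  ultimately show ?thesis by simp
qed

definition stable :: "(real ^ 'v) set" where
  "stable = {w. J w < ground \<and> (N w > 0 \<or> w = 0)}"

definition unstable :: "(real ^ 'v) set" where
  "unstable = {w. J w < ground \<and> N w < 0}"

lemma J_zero: "J 0 = 0" and N_zero: "N 0 = 0"
  by (simp_all add: J_eq N_eq forms_at_zero)

text \<open>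
  The function \<open>0\<close> belongs to the stable set by definition; its energy \<open>0\<close> is below the ground level
  by \<open>ground_pos\<close>, so the bound on \<open>J\<close> may be imposed on it too.
\<close>

lemma stable_iff: "w \<in> stable \<longleftrightarrow> ($) w \<in> stable_set G p a"
  using ground_pos nonzero_iff_nth_nonzero[of w] J_zero
  by (auto simp: stable_def stable_set_def)

lemma unstable_iff: "w \<in> unstable \<longleftrightarrow> ($) w \<in> unstable_set G p a"
  by (auto simp: unstable_def unstable_set_def)

text \<open>
  On the stable set \<open>N \<ge> 0\<close>, so \<open>J < r\<close> bounds the Dirichlet form and with it the norm.
\<close>

lemma stable_bounded:
  obtains M where "\<And>w. w \<in> stable \<Longrightarrow> norm w \<le> M"
proof -
  obtain c where c: "c > 0" "\<And>w. c * (norm w)\<^sup>2 \<le> dirichlet w"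
    using dirichlet_lower by blast
  define \<theta> where "\<theta> = (p - 1) / (2 * (p + 1))"
  have \<theta>: "\<theta> > 0" using p_gt_1 by (simp add: \<theta>_def)
  have "norm w \<le> sqrt (ground / (\<theta> * c))" if "w \<in> stable" for w
  proof (rule real_le_rsqrt)
    have "N w \<ge> 0"
      using that N_zero by (auto simp: stable_def)
    then have "\<theta> * dirichlet w \<le> J w"
      using p_gt_1 by (simp add: J_eq_N \<theta>_def)
    moreover have "\<theta> * (c * (norm w)\<^sup>2) \<le> \<theta> * dirichlet w"
      using \<theta> c(2) by (intro mult_left_mono) auto
    ultimately have "\<theta> * (c * (norm w)\<^sup>2) \<le> ground"
      using that by (simp add: stable_def)
    then show "(norm w)\<^sup>2 \<le> ground / (\<theta> * c)"
      using \<theta> c by (simp add: field_simps)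
  qed
  then show thesis
    using that by blast
qed

section \<open>Energy identities along the flow\<close>

definition field :: "real ^ 'v \<Rightarrow> real ^ 'v" where
  "field w = (\<chi> x. laplacian G (($) w) x - a x * w $ x + \<bar>w $ x\<bar> powr (p - 1) * w $ x)"

text \<open>
  The factor \<open>a w - \<Delta> w\<close> is the gradient of half the Dirichlet form for the inner product weighted by \<open>\<mu>\<close>.
\<close>

lemma dirichlet_has_derivative:
  assumes "(w has_vector_derivative d) (at t)"
  shows "((\<lambda>t. dirichlet (w t)) has_real_derivative
    2 * vertex_integral G (\<lambda>x. (a x * w t $ x - laplacian G (($) (w t)) x) * d $ x)) (at t)"
proof -
  have comp: "((\<lambda>t. w t $ x) has_real_derivative d $ x) (at t)" for x
    using assms by (simp add: has_vector_derivative_cart)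
  have eq: "dirichlet v = 1 / 2 * (\<Sum>x\<in>UNIV. \<Sum>y | adj G x y. weight G x y * (v $ y - v $ x)\<^sup>2)
      + (\<Sum>x\<in>UNIV. meas G x * (a x * (v $ x)\<^sup>2))" for v
    using meas_pos[THEN less_imp_neq]
    by (simp add: dirichlet_def vertex_integral_def grad_sq_def distrib_left sum.distrib sum_distrib_left)
  have "((\<lambda>t. dirichlet (w t)) has_real_derivative
      1 / 2 * (\<Sum>x\<in>UNIV. \<Sum>y | adj G x y. weight G x y * (2 * ((w t $ y - w t $ x) * (d $ y - d $ x))))
      + (\<Sum>x\<in>UNIV. meas G x * (a x * (2 * (w t $ x * d $ x))))) (at t)"
    unfolding eq
    by (rule derivative_eq_intros comp refl | simp add: algebra_simps)+
  moreover have "1 / 2 * (\<Sum>x\<in>UNIV. \<Sum>y | adj G x y. weight G x y * (2 * ((w t $ y - w t $ x) * (d $ y - d $ x))))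
      = (\<Sum>x\<in>UNIV. \<Sum>y | adj G x y. weight G x y * ((w t $ y - w t $ x) * (d $ y - d $ x)))"
    by (simp add: sum_distrib_left)
  moreover have "2 * vertex_integral G (\<lambda>x. (a x * w t $ x - laplacian G (($) (w t)) x) * d $ x)
      = - 2 * vertex_integral G (\<lambda>x. laplacian G (($) (w t)) x * d $ x)
        + (\<Sum>x\<in>UNIV. meas G x * (a x * (2 * (w t $ x * d $ x))))"
    by (simp add: vertex_integral_def sum_distrib_left algebra_simps sum_subtractf sum_negf)
  ultimately show ?thesis
    by (simp only: green_formula)
qed

lemma power_mass_has_derivative:
  assumes "(w has_vector_derivative d) (at t)"
  shows "((\<lambda>t. power_mass (w t)) has_real_derivative
    (p + 1) * vertex_integral G (\<lambda>x. \<bar>w t $ x\<bar> powr (p - 1) * w t $ x * d $ x)) (at t)"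
proof -
  have comp: "((\<lambda>t. w t $ x) has_real_derivative d $ x) (at t)" for x
    using assms by (simp add: has_vector_derivative_cart)
  have "((\<lambda>t. \<bar>w t $ x\<bar> powr (p + 1)) has_real_derivative
      (p + 1) * (\<bar>w t $ x\<bar> powr (p - 1) * w t $ x) * d $ x) (at t)" for x
    using DERIV_chain2[OF abs_powr_has_real_derivative comp, of "p + 1"] p_gt_1 by simp
  then show ?thesis
    unfolding power_mass_def vertex_integral_def sum_distrib_left
    by (intro DERIV_cong[OF DERIV_sum[OF DERIV_cmult]]) (auto simp: algebra_simps intro!: sum.cong)
qed

text \<open>
  Pairing the field with \<open>w\<close> gives \<open>- N(w)\<close>, by Green's formula with both arguments equal to \<open>w\<close>.
\<close>

lemma mass_has_derivative:
  assumes "(w has_vector_derivative field (w t)) (at t)"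
  shows "((\<lambda>t. mass (w t)) has_real_derivative - 2 * N (w t)) (at t)"
proof -
  have comp: "((\<lambda>t. w t $ x) has_real_derivative field (w t) $ x) (at t)" for x
    using assms by (simp add: has_vector_derivative_cart)
  have "((\<lambda>t. mass (w t)) has_real_derivative
      2 * vertex_integral G (\<lambda>x. w t $ x * field (w t) $ x)) (at t)"
    unfolding mass_def vertex_integral_def sum_distrib_left
    by (rule derivative_eq_intros comp refl | simp add: algebra_simps)+
  moreover have "vertex_integral G (\<lambda>x. w t $ x * field (w t) $ x) = - N (w t)"
  proof -
    define v where "v = w t"
    have green: "2 * vertex_integral G (grad_sq G (($) v)) = - 2 * vertex_integral G (\<lambda>x. laplacian G (($) v) x * v $ x)"
      using green_formula[of "($) v" "($) v"] meas_pos[THEN less_imp_neq]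
      by (simp add: vertex_integral_def grad_sq_def sum_distrib_left power2_eq_square)
    have pw: "\<bar>s\<bar> powr (p + 1) = \<bar>s\<bar> powr (p - 1) * s\<^sup>2" for s :: real
      using powr_add[of "\<bar>s\<bar>" "p - 1" 2] by (cases "s = 0") (auto simp: add.commute)
    have "power_mass v = vertex_integral G (\<lambda>x. \<bar>v $ x\<bar> powr (p - 1) * (v $ x)\<^sup>2)"
      by (simp only: power_mass_def pw)
    then have "vertex_integral G (\<lambda>x. v $ x * field v $ x) =
        vertex_integral G (\<lambda>x. laplacian G (($) v) x * v $ x)
        - vertex_integral G (\<lambda>x. a x * (v $ x)\<^sup>2) + power_mass v"
      by (simp add: vertex_integral_def field_def power2_eq_square algebra_simps
          sum.distrib sum_subtractf)
    moreover have "dirichlet v = vertex_integral G (grad_sq G (($) v)) + vertex_integral G (\<lambda>x. a x * (v $ x)\<^sup>2)"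
      by (simp add: dirichlet_def vertex_integral_def algebra_simps sum.distrib)
    ultimately show ?thesis
      using green by (simp add: N_eq v_def)
  qed
  ultimately show ?thesis by simp
qed

text \<open>
  The field is minus the gradient of \<open>J\<close> for the inner product weighted by \<open>\<mu>\<close>.
\<close>

lemma J_has_derivative:
  assumes "(w has_vector_derivative field (w t)) (at t)"
  shows "((\<lambda>t. J (w t)) has_real_derivative - mass (field (w t))) (at t)"
proof -
  have "((\<lambda>t. J (w t)) has_real_derivative
      vertex_integral G (\<lambda>x. (a x * w t $ x - laplacian G (($) (w t)) x) * field (w t) $ x)
      - vertex_integral G (\<lambda>x. \<bar>w t $ x\<bar> powr (p - 1) * w t $ x * field (w t) $ x)) (at t)"
    unfolding J_eq
    using p_gt_1 dirichlet_has_derivative[OF assms] power_mass_has_derivative[OF assms]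
    by (auto intro!: derivative_eq_intros)
  moreover have "vertex_integral G (\<lambda>x. (a x * w t $ x - laplacian G (($) (w t)) x) * field (w t) $ x)
      - vertex_integral G (\<lambda>x. \<bar>w t $ x\<bar> powr (p - 1) * w t $ x * field (w t) $ x)
      = - mass (field (w t))"
    unfolding vertex_integral_def mass_def sum_subtractf[symmetric] sum_negf[symmetric]
    by (intro sum.cong refl) (simp add: field_def power2_eq_square algebra_simps)
  ultimately show ?thesis by simp
qed

section \<open>Invariance of the stable and unstable sets\<close>

text \<open>
  Below the ground level \<open>N\<close> vanishes at most at \<open>0\<close>, and near \<open>0\<close> it is nonnegative.  Hence a small ball
  together with \<open>{N > 0}\<close>, and \<open>{N < 0}\<close>, are disjoint open sets that cover \<open>X\<close>.
\<close>

lemma sublevel_connected_cases: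
  assumes "connected X" "\<And>w. w \<in> X \<Longrightarrow> J w < ground"
  shows "X \<subseteq> stable \<or> X \<subseteq> unstable"
proof -
  obtain \<delta> where \<delta>: "\<delta> > 0" "\<And>w. norm w < \<delta> \<Longrightarrow> w \<noteq> 0 \<Longrightarrow> N w > 0"
    using N_pos_near_0 by blast
  define U where "U = {w. 0 < N w} \<union> ball 0 \<delta>"
  define V where "V = {w. N w < 0}"
  have "open U" "open V"
    unfolding U_def V_def
    by (intro open_Un open_ball open_Collect_less continuous_on_const continuous_on_N)+
  moreover have "U \<inter> V = {}"
    using \<delta>(2) N_zero by (force simp: U_def V_def)
  moreover have "w \<in> U \<or> w \<in> V" if "J w < ground" for w
    using that ground_le_J[of w] \<delta>(1) by (cases "w = 0") (force simp: U_def V_def)+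
  ultimately have "U \<inter> X = {} \<or> V \<inter> X = {}" "X \<subseteq> U \<union> V"
    using connectedD[OF assms(1), of U V] assms(2) by blast+
  then have "X \<subseteq> U \<or> X \<subseteq> V"
    by blast
  moreover have "w \<in> U \<Longrightarrow> N w > 0 \<or> w = 0" for w
    using \<delta>(2) by (auto simp: U_def)
  ultimately show ?thesis
    using assms(2) by (auto simp: stable_def unstable_def V_def)
qed

text \<open>
  At \<open>t = 0\<close> only continuity is asked for; the differential equation holds at interior times.
\<close>

definition flow_on :: "ereal \<Rightarrow> (real \<Rightarrow> real ^ 'v) \<Rightarrow> bool" where
  "flow_on T w \<longleftrightarrow> continuous_on (time_interval T) w \<and>
    (\<forall>t\<in>time_interval T. 0 < t \<longrightarrow> (w has_vector_derivative field (w t)) (at t))"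

lemma flow_on_compose_continuous:
  assumes "flow_on T w" "continuous_on UNIV f" "S \<subseteq> time_interval T"
  shows "continuous_on S (\<lambda>t. f (w t))"
  using assms by (auto simp: flow_on_def intro: continuous_on_compose2 continuous_on_subset)

lemma J_flow_decreasing:
  assumes flow: "flow_on T w" and "t \<in> time_interval T" "0 \<le> s" "s \<le> t"
  shows "J (w t) \<le> J (w s)"
proof (rule DERIV_nonpos_imp_decreasing_open[of s t "\<lambda>t. J (w t)"])
  have sub: "{s..t} \<subseteq> time_interval T"
    using time_interval_initial_segment[OF assms(2)] assms(3) by auto
  then show "continuous_on {s..t} (\<lambda>t. J (w t))"
    by (intro flow_on_compose_continuous[OF flow] continuous_on_J)
  fix r assume r: "s < r" "r < t"
  then have "r \<in> time_interval T"
    using sub by auto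
  then have "(w has_vector_derivative field (w r)) (at r)"
    using flow r assms(3) by (auto simp: flow_on_def)
  then show "\<exists>y. ((\<lambda>t. J (w t)) has_real_derivative y) (at r) \<and> y \<le> 0"
    using J_has_derivative mass_nonneg by (meson neg_le_0_iff_le)
qed (fact assms(4))

lemma flow_invariant:
  assumes flow: "flow_on T w" and t: "t \<in> time_interval T"
  shows "w 0 \<in> stable \<Longrightarrow> w t \<in> stable" "w 0 \<in> unstable \<Longrightarrow> w t \<in> unstable"
proof -
  have t0: "0 \<le> t" using t by (simp add: time_interval_def)
  have ti: "{0..t} \<subseteq> time_interval T"
    using t by (rule time_interval_initial_segment)
  have conn: "connected (w ` {0..t})"
    using flow ti by (intro connected_continuous_image) (auto simp: flow_on_def intro: continuous_on_subset)
  have mem: "w 0 \<in> w ` {0..t}" "w t \<in> w ` {0..t}"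
    using t0 by auto
  have disj: "stable \<inter> unstable = {}"
    using N_zero by (auto simp: stable_def unstable_def)
  have cases: "w ` {0..t} \<subseteq> stable \<or> w ` {0..t} \<subseteq> unstable" if "J (w 0) < ground"
    using conn
  proof (rule sublevel_connected_cases)
    fix v assume "v \<in> w ` {0..t}"
    then show "J v < ground"
      using J_flow_decreasing[OF flow, of _ 0] ti that by force
  qed
  show "w 0 \<in> stable \<Longrightarrow> w t \<in> stable"
    using cases mem disj by (auto simp: stable_def)
  show "w 0 \<in> unstable \<Longrightarrow> w t \<in> unstable"
    using cases mem disj by (auto simp: unstable_def)
qed

section \<open>Global existence from stable data\<close>

definition truncate :: "real \<Rightarrow> real \<Rightarrow> real" where
  "truncate K s = max (- K) (min K s)"

definition truncated_field :: "real \<Rightarrow> real ^ 'v \<Rightarrow> real ^ 'v" where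
  "truncated_field K w = (\<chi> x. laplacian G (($) w) x - a x * w $ x) +
    (\<chi> x. \<bar>truncate K (w $ x)\<bar> powr (p - 1) * truncate K (w $ x))"

lemma truncated_field_eq: "norm w \<le> K \<Longrightarrow> truncated_field K w = field w"
proof -
  assume "norm w \<le> K"
  then have "\<bar>w $ x\<bar> \<le> K" for x
    using component_le_norm_cart order_trans by blast
  then have "truncate K (w $ x) = w $ x" for x
    by (auto simp: truncate_def abs_le_iff max_def min_def intro: antisym) (smt (verit))+
  then show ?thesis
    by (simp add: truncated_field_def field_def vec_eq_iff)
qed

text \<open>
  The linear part is Lipschitz in finite dimension; the power is Lipschitz on the range \<open>[-K, K]\<close> of the
  truncation, which is itself \<open>1\<close>-Lipschitz.
\<close>

lemma truncated_field_lipschitz: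
  assumes K: "K \<ge> 0"
  obtains L where "L-lipschitz_on UNIV (truncated_field K)"
proof -
  have "linear (\<lambda>w. \<chi> x. laplacian G (($) w) x - a x * w $ x)"
    by (rule linearI)
      (auto simp: vec_eq_iff laplacian_def algebra_simps sum.distrib sum_subtractf sum_distrib_left add_divide_distrib diff_divide_distrib sum_divide_distrib)
  then obtain B where B: "B-lipschitz_on UNIV (\<lambda>w. \<chi> x. laplacian G (($) w) x - a x * w $ x)"
    using bounded_linear.lipschitz_boundE linear_conv_bounded_linear by blast
  define g where "g s = \<bar>s\<bar> powr (p - 1) * s" for s
  define L where "L = p * K powr (p - 1)"
  have g: "\<bar>g (truncate K s) - g (truncate K t)\<bar> \<le> L * \<bar>s - t\<bar>" for s t
  proof -
    have "truncate K r \<in> {-K..K}" for r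
      using K by (auto simp: truncate_def)
    then have "\<bar>g (truncate K s) - g (truncate K t)\<bar> \<le> L * \<bar>truncate K s - truncate K t\<bar>"
      using lipschitz_onD[OF signed_powr_lipschitz[OF p_gt_1]]
      by (simp add: g_def L_def dist_real_def)
    also have "\<dots> \<le> L * \<bar>s - t\<bar>"
      using p_gt_1 by (intro mult_left_mono) (auto simp: L_def truncate_def)
    finally show ?thesis .
  qed
  have "(real CARD('v) * L)-lipschitz_on UNIV (\<lambda>w :: real ^ 'v. \<chi> x. g (truncate K (w $ x)))"
  proof (rule lipschitz_onI)
    fix v w :: "real ^ 'v"
    have "norm ((\<chi> x. g (truncate K (v $ x))) - (\<chi> x. g (truncate K (w $ x))))
        \<le> (\<Sum>x\<in>UNIV. \<bar>g (truncate K (v $ x)) - g (truncate K (w $ x))\<bar>)"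
      by (rule order_trans[OF norm_le_l1_cart]) simp
    also have "\<dots> \<le> (\<Sum>x\<in>(UNIV :: 'v set). L * norm (v - w))"
    proof (intro sum_mono)
      fix x
      have "\<bar>v $ x - w $ x\<bar> \<le> norm (v - w)"
        using component_le_norm_cart[of "v - w" x] by simp
      then have "L * \<bar>v $ x - w $ x\<bar> \<le> L * norm (v - w)"
        using p_gt_1 by (intro mult_left_mono) (auto simp: L_def)
      then show "\<bar>g (truncate K (v $ x)) - g (truncate K (w $ x))\<bar> \<le> L * norm (v - w)"
        using g[of "v $ x" "w $ x"] by linarith
    qed
    finally show "dist (\<chi> x. g (truncate K (v $ x))) (\<chi> x. g (truncate K (w $ x)))
        \<le> real CARD('v) * L * dist v w"
      by (simp add: dist_norm)
  qed (use p_gt_1 in \<open>simp add: L_def\<close>)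
  from lipschitz_on_add[OF B this] show thesis
    using that unfolding truncated_field_def g_def by blast
qed

text \<open>
  A solution of the truncated equation solves the original one until its norm first reaches
  \<open>K = M + 1\<close>.  Up to that time it stays in the stable set, so its norm is at most \<open>M\<close>, and by
  continuity this persists at that time: a contradiction.
\<close>

lemma stable_global_flow:
  assumes w0: "w0 \<in> stable"
  obtains w where "w 0 = w0"
    "\<And>t. t \<ge> 0 \<Longrightarrow> (w has_vector_derivative field (w t)) (at t within {0..})"
proof -
  obtain M where M: "\<And>w. w \<in> stable \<Longrightarrow> norm w \<le> M"
    using stable_bounded by blast
  define K where "K = M + 1"
  have "M \<ge> 0"
    using M[OF w0] norm_ge_zero order_trans by blast
  then obtain L where "L-lipschitz_on UNIV (truncated_field K)"
    using truncated_field_lipschitz[of K] by (auto simp: K_def)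
  then obtain w where w: "w 0 = w0"
      "\<And>t. t \<ge> 0 \<Longrightarrow> (w has_vector_derivative truncated_field K (w t)) (at t within {0..})"
    using lipschitz_field_global_solution by blast
  have cont: "continuous_on {0..} w"
    using w(2) by (meson atLeast_iff continuous_on_eq_continuous_within has_vector_derivative_continuous)
  have flow: "flow_on (ereal T) w" if "\<And>t. 0 \<le> t \<Longrightarrow> t < T \<Longrightarrow> norm (w t) \<le> K" for T
    unfolding flow_on_def
  proof (intro conjI ballI impI)
    show "continuous_on (time_interval (ereal T)) w"
      using cont by (rule continuous_on_subset) (auto simp: time_interval_def)
    fix t assume t: "t \<in> time_interval (ereal T)" "0 < t"
    have "at t within {0..} = at t"
      using t at_within_time_interval[of t \<infinity>] by simp
    moreover have "truncated_field K (w t) = field (w t)"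
      using t that[of t] truncated_field_eq by (simp add: time_interval_def)
    ultimately show "(w has_vector_derivative field (w t)) (at t)"
      using w(2)[of t] t by simp
  qed
  have bound: "norm (w t) \<le> K" if "t \<ge> 0" for t
  proof (rule ccontr)
    assume nt: "\<not> norm (w t) \<le> K"
    define S where "S = {0..} \<inter> (\<lambda>t. norm (w t)) -` {K..}"
    have "closed S"
      unfolding S_def by (intro continuous_closed_preimage continuous_intros cont)
    moreover have "S \<noteq> {}" "bdd_below S"
      using nt that by (auto simp: S_def intro!: exI[of _ t] bdd_belowI[of _ 0])
    ultimately have T: "Inf S \<in> S"
      using closed_contains_Inf by blast
    define T where "T = Inf S"
    have before: "norm (w s) < K" if "0 \<le> s" "s < T" for s
      using that cInf_lower[OF _ \<open>bdd_below S\<close>, of s] by (force simp: S_def T_def)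
    have T0: "T \<ge> 0" "norm (w T) \<ge> K"
      using T by (auto simp: S_def T_def)
    have "T \<noteq> 0"
      using T0 M[OF w0] w(1) by (auto simp: K_def)
    then have "T > 0" using T0 by simp
    have "norm (w s) \<le> M" if "s \<in> {0..<T}" for s
    proof (rule M)
      have "flow_on (ereal T) w"
        using before by (intro flow) (auto intro: less_imp_le)
      then show "w s \<in> stable"
        using flow_invariant(1)[of "ereal T" w s] that w0 w(1) by (simp add: time_interval_def)
    qed
    moreover have "closure {0..<T} = {0..T}"
      using \<open>T > 0\<close> by simp
    moreover have "continuous_on {0..T} (\<lambda>t. norm (w t))"
      using cont by (intro continuous_intros) (auto elim: continuous_on_subset)
    ultimately have "norm (w T) \<le> M"
      using continuous_le_on_closure[of "{0..<T}" "\<lambda>t. norm (w t)" T M] T0 by auto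
    then show False
      using T0 by (simp add: K_def)
  qed
  show thesis
    using w bound truncated_field_eq by (intro that[of w]) auto
qed

section \<open>Decay of stable flows\<close>

text \<open>
  The quantity \<open>\<integral> w\<^sup>2\<close> decreases at the rate \<open>2 N(w)\<close>.  If it stayed above some \<open>e > 0\<close>, then \<open>N\<close> would have a
  positive lower bound along the trajectory, by compactness, and \<open>\<integral> w\<^sup>2\<close> would reach \<open>0\<close> in finite time.
\<close>

lemma stable_flow_decay:
  assumes flow: "flow_on \<infinity> w" and w0: "w 0 \<in> stable"
  shows "((\<lambda>t. norm (w t)) \<longlongrightarrow> 0) at_top"
proof -
  have stable: "w t \<in> stable" if "t \<ge> 0" for t
    using flow_invariant(1)[OF flow _ w0, of t] that by simp
  have N_nonneg: "N v \<ge> 0" if "v \<in> stable" for v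
    using that N_zero by (auto simp: stable_def)
  have deriv: "((\<lambda>t. mass (w t)) has_real_derivative - 2 * N (w t)) (at t)" if "t > 0" for t
    using flow that by (intro mass_has_derivative) (auto simp: flow_on_def)
  have cont: "continuous_on {s..t} (\<lambda>t. mass (w t))" if "s \<ge> 0" for s t
    using that by (intro flow_on_compose_continuous[OF flow] continuous_on_mass) auto
  have mono: "mass (w t) \<le> mass (w s)" if "0 \<le> s" "s \<le> t" for s t
  proof (rule DERIV_nonpos_imp_decreasing_open[OF that(2), of "\<lambda>t. mass (w t)"])
    show "\<exists>y. ((\<lambda>t. mass (w t)) has_real_derivative y) (at r) \<and> y \<le> 0" if "s < r" "r < t" for r
      using deriv[of r] N_nonneg[OF stable[of r]] that \<open>0 \<le> s\<close>
      by (intro exI[of _ "- 2 * N (w r)"]) auto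
  qed (use cont that in auto)
  obtain M where M: "\<And>w. w \<in> stable \<Longrightarrow> norm w \<le> M"
    using stable_bounded by blast
  have small: "\<exists>t\<ge>0. mass (w t) < e" if "e > 0" for e
  proof (rule ccontr)
    assume "\<not> (\<exists>t\<ge>0. mass (w t) < e)"
    then have ge: "mass (w t) \<ge> e" if "t \<ge> 0" for t
      using that by force
    \<comment> \<open>The conditions are closed: \<open>N \<ge> 0\<close> instead of \<open>N > 0\<close>, and \<open>J \<le> J(w 0)\<close> instead of \<open>J < r\<close>.  The set still
      avoids the zeros of \<open>N\<close>, since \<open>0\<close> is excluded and \<open>J(w 0) < r\<close>.\<close>
    define C where "C = {v. J v \<le> J (w 0)} \<inter> {v. 0 \<le> N v} \<inter> {v. e \<le> mass v} \<inter> cball 0 M"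
    have C: "w t \<in> C" if "t \<ge> 0" for t
      using that J_flow_decreasing[OF flow, of t 0] N_nonneg stable M ge by (simp add: C_def)
    have "compact C"
      unfolding C_def
      by (intro closed_Int_compact closed_Int compact_cball closed_Collect_le continuous_on_J
          continuous_on_N continuous_on_mass continuous_on_const)
    then obtain v where v: "v \<in> C" "\<And>x. x \<in> C \<Longrightarrow> N v \<le> N x"
      using continuous_attains_inf[of C N] continuous_on_N C[of 0] by blast
    have "v \<noteq> 0"
      using v(1) forms_at_zero that by (auto simp: C_def)
    moreover have "J v < ground"
      using v(1) w0 by (auto simp: C_def stable_def)
    ultimately have "N v \<noteq> 0"
      using ground_le_J[of v] by auto
    then have Nv: "N v > 0"
      using v(1) by (auto simp: C_def)
    define t where "t = mass (w 0) / (2 * N v)"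
    have t: "t \<ge> 0"
      using Nv mass_nonneg by (simp add: t_def)
    have "mass (w t) + 2 * N v * t \<le> mass (w 0) + 2 * N v * 0"
    proof (rule DERIV_nonpos_imp_decreasing_open[OF t, of "\<lambda>t. mass (w t) + 2 * N v * t"])
      show "\<exists>y. ((\<lambda>t. mass (w t) + 2 * N v * t) has_real_derivative y) (at r) \<and> y \<le> 0"
        if "0 < r" "r < t" for r
        using that v(2)[OF C[of r]]
        by (intro exI[of _ "- 2 * N (w r) + 2 * N v"]) (auto intro!: derivative_eq_intros deriv)
    qed (intro continuous_intros cont, simp)
    then have "mass (w t) \<le> 0"
      using Nv by (simp add: t_def)
    then show False
      using ge[OF t] that by simp
  qed
  have "((\<lambda>t. mass (w t)) \<longlongrightarrow> 0) at_top"
  proof (rule order_tendstoI)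
    fix e :: real assume "0 < e"
    then obtain s where s: "s \<ge> 0" "mass (w s) < e"
      using small by blast
    then have "mass (w t) < e" if "t \<ge> s" for t
      using mono[of s t] that by simp
    then show "\<forall>\<^sub>F t in at_top. mass (w t) < e"
      by (auto simp: eventually_at_top_linorder)
  next
    fix e :: real assume "e < 0"
    then show "\<forall>\<^sub>F t in at_top. e < mass (w t)"
      by (intro always_eventually allI less_le_trans[OF _ mass_nonneg])
  qed
  moreover obtain c where c: "c > 0" "\<And>w. c * (norm w)\<^sup>2 \<le> mass w"
    using mass_lower by blast
  ultimately have "((\<lambda>t. sqrt (mass (w t) / c)) \<longlongrightarrow> 0) at_top"
    using tendsto_real_sqrt[OF tendsto_divide[OF _ tendsto_const, of _ 0 _ c]] by fastforce
  then show ?thesis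
  proof (rule tendsto_0_le[where K = 1], intro always_eventually allI)
    fix t
    have "norm (w t) \<le> sqrt (mass (w t) / c)"
      using c by (intro real_le_rsqrt) (simp add: field_simps)
    then show "norm (norm (w t)) \<le> norm (sqrt (mass (w t) / c)) * 1"
      by simp
  qed
qed

section \<open>Blow-up of unstable flows\<close>

text \<open>
  For \<open>\<bar>v\<bar> \<ge> R\<close> the identity \<open>N = 2 J - (p - 1) / (p + 1) \<integral> \<bar>v\<bar>\<^sup>p\<^sup>+\<^sup>1\<close> makes \<open>N\<close> as negative as the power term, once that
  term absorbs the bounded contribution of \<open>J\<close>.  For \<open>\<bar>v\<bar> \<le> R\<close> the points with \<open>N < 0\<close> keep a distance
  from \<open>0\<close>, so they lie in a compact set on which \<open>N\<close> has a negative maximum.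
\<close>

lemma unstable_N_bound:
  assumes j: "j < ground"
  obtains \<kappa> where "\<kappa> > 0"
    "\<And>v. J v \<le> j \<Longrightarrow> N v < 0 \<Longrightarrow> N v \<le> - \<kappa> * norm v powr (p + 1)"
proof -
  obtain c where c: "c > 0" "\<And>w. c * norm w powr (p + 1) \<le> power_mass w"
    using power_mass_lower by blast
  obtain \<delta> where \<delta>: "\<delta> > 0" "\<And>w. norm w < \<delta> \<Longrightarrow> w \<noteq> 0 \<Longrightarrow> N w > 0"
    using N_pos_near_0 by blast
  define b where "b = (p - 1) / (p + 1) * c"
  have b: "b > 0" using c p_gt_1 by (simp add: b_def)
  \<comment> \<open>Chosen such that \<open>4 \<bar>j\<bar> / b \<le> \<bar>v\<bar>\<^sup>p\<^sup>+\<^sup>1\<close> for \<open>\<bar>v\<bar> \<ge> R\<close>; the summand \<open>1\<close> keeps \<open>R\<close> positive when \<open>j = 0\<close>.\<close>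
  define R where "R = (4 * \<bar>j\<bar> / b) powr (1 / (p + 1)) + 1"
  have R: "R > 0" by (simp add: R_def add_nonneg_pos)
  have large: "N v \<le> - (b / 2) * norm v powr (p + 1)" if "J v \<le> j" "norm v \<ge> R" for v
  proof -
    have "((4 * \<bar>j\<bar> / b) powr (1 / (p + 1))) powr (p + 1) \<le> norm v powr (p + 1)"
      using that(2) p_gt_1 by (intro powr_mono2) (auto simp: R_def)
    then have "4 * \<bar>j\<bar> / b \<le> norm v powr (p + 1)"
      using p_gt_1 b by (simp add: powr_powr)
    then have "2 * j \<le> b / 2 * norm v powr (p + 1)"
      using b by (simp add: field_simps)
    moreover have "(p - 1) / (p + 1) = 1 - 2 / (p + 1)"
      using p_gt_1 by (simp add: field_simps)
    then have "N v = 2 * J v - (p - 1) / (p + 1) * power_mass v"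
      by (simp add: N_eq J_eq left_diff_distrib)
    moreover have "b * norm v powr (p + 1) \<le> (p - 1) / (p + 1) * power_mass v"
      unfolding b_def mult.assoc using c p_gt_1 by (intro mult_left_mono) auto
    ultimately show ?thesis
      using that(1) by simp
  qed
  define C where "C = {v. J v \<le> j} \<inter> {v. N v \<le> 0} \<inter> {v. \<delta> \<le> norm v} \<inter> cball 0 R"
  have mem: "v \<in> C" if "J v \<le> j" "N v < 0" "norm v \<le> R" for v
    using that \<delta>(2)[of v] N_zero by (force simp: C_def)
  have "compact C"
    unfolding C_def
    by (intro closed_Int_compact closed_Int compact_cball closed_Collect_le continuous_on_J
        continuous_on_N continuous_on_norm continuous_on_id continuous_on_const)
  have "\<exists>m>0. \<forall>v\<in>C. N v \<le> - m"
  proof (cases "C = {}")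
    case False
    then obtain z where z: "z \<in> C" "\<And>v. v \<in> C \<Longrightarrow> N v \<le> N z"
      using continuous_attains_sup[OF \<open>compact C\<close>] continuous_on_N by blast
    \<comment> \<open>The maximum \<open>N z \<le> 0\<close> is not \<open>0\<close>: below the ground level \<open>N\<close> has no zero other than the origin.\<close>
    have "z \<noteq> 0" "J z < ground"
      using z(1) \<delta>(1) j by (auto simp: C_def)
    then have "N z \<noteq> 0"
      using ground_le_J[of z] by auto
    then have "N z < 0"
      using z(1) by (auto simp: C_def)
    then show ?thesis
      using z(2) by (intro exI[of _ "- N z"]) auto
  qed (auto intro: exI[of _ 1])
  then obtain m where m: "m > 0" "\<And>v. v \<in> C \<Longrightarrow> N v \<le> - m"
    by blast
  define \<kappa> where "\<kappa> = min (b / 2) (m / R powr (p + 1))"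
  show thesis
  proof
    show "\<kappa> > 0"
      using b m R by (simp add: \<kappa>_def)
    fix v assume v: "J v \<le> j" "N v < 0"
    show "N v \<le> - \<kappa> * norm v powr (p + 1)"
    proof (cases "norm v \<ge> R")
      case True
      have "\<kappa> * norm v powr (p + 1) \<le> b / 2 * norm v powr (p + 1)"
        by (intro mult_right_mono) (simp_all only: \<kappa>_def min.cobounded1 powr_ge_zero)
      then show ?thesis
        using large[OF v(1) True] by simp
    next
      case False
      have "\<kappa> * norm v powr (p + 1) \<le> m / R powr (p + 1) * R powr (p + 1)"
        using False p_gt_1 m(1) by (intro mult_mono powr_mono2) (auto simp: \<kappa>_def)
      then show ?thesis
        using m(2)[OF mem[OF v]] False R by simp
    qed
  qed
qed

text \<open>
  Since \<open>\<integral> w\<^sup>2\<close> is at most of order \<open>\<bar>w\<bar>\<^sup>2\<close>, the bound on \<open>N\<close> turns \<open>(\<integral> w\<^sup>2)' = - 2 N(w)\<close> into a superlinear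
  differential inequality for \<open>\<integral> w\<^sup>2\<close>.
\<close>

lemma unstable_flow_not_global:
  assumes flow: "flow_on \<infinity> w" and w0: "w 0 \<in> unstable"
  shows False
proof -
  have unstable: "w t \<in> unstable" if "t \<ge> 0" for t
    using flow_invariant(2)[OF flow _ w0, of t] that by simp
  obtain \<kappa> where \<kappa>: "\<kappa> > 0"
      "\<And>v. J v \<le> J (w 0) \<Longrightarrow> N v < 0 \<Longrightarrow> N v \<le> - \<kappa> * norm v powr (p + 1)"
    using unstable_N_bound[of "J (w 0)"] w0 by (auto simp: unstable_def)
  obtain C where C: "C > 0" "\<And>w. mass w \<le> C * (norm w)\<^sup>2"
    using mass_upper by blast
  define \<gamma> where "\<gamma> = (p + 1) / 2"
  have \<gamma>: "\<gamma> > 1" using p_gt_1 by (simp add: \<gamma>_def)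
  have two_\<gamma>: "2 * \<gamma> = p + 1" by (simp add: \<gamma>_def)
  have mass_le: "mass v powr \<gamma> \<le> C powr \<gamma> * norm v powr (p + 1)" for v
  proof -
    have "mass v powr \<gamma> \<le> (C * (norm v)\<^sup>2) powr \<gamma>"
      using C(2) mass_nonneg \<gamma> by (intro powr_mono2) auto
    also have "\<dots> = C powr \<gamma> * (norm v powr 2) powr \<gamma>"
      using C(1) by (simp add: powr_mult)
    also have "(norm v powr 2) powr \<gamma> = norm v powr (p + 1)"
      using two_\<gamma> by (simp only: powr_powr)
    finally show ?thesis .
  qed
  show False
  proof (rule superlinear_growth_blows_up[OF \<gamma>])
    show "2 * \<kappa> / C powr \<gamma> > 0"
      using \<kappa> C by simp
    show "continuous_on {0..} (\<lambda>t. mass (w t))"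
      by (intro flow_on_compose_continuous[OF flow] continuous_on_mass) simp
    show "mass (w t) > 0" if "t \<ge> 0" for t
      using unstable[OF that] N_zero by (intro mass_pos) (auto simp: unstable_def)
    fix t :: real assume t: "t > 0"
    have "N (w t) \<le> - \<kappa> * norm (w t) powr (p + 1)"
      using unstable[of t] J_flow_decreasing[OF flow, of t 0] t by (intro \<kappa>) (auto simp: unstable_def)
    moreover have "\<kappa> / C powr \<gamma> * mass (w t) powr \<gamma> \<le> \<kappa> / C powr \<gamma> * (C powr \<gamma> * norm (w t) powr (p + 1))"
      using \<kappa> C mass_le by (intro mult_left_mono) auto
    ultimately have "2 * \<kappa> / C powr \<gamma> * mass (w t) powr \<gamma> \<le> - 2 * N (w t)"
      using C by simp
    moreover have "((\<lambda>t. mass (w t)) has_real_derivative - 2 * N (w t)) (at t)"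
      using flow t by (intro mass_has_derivative) (auto simp: flow_on_def)
    ultimately show "\<exists>d. ((\<lambda>t. mass (w t)) has_real_derivative d) (at t) \<and>
        d \<ge> 2 * \<kappa> / C powr \<gamma> * mass (w t) powr \<gamma>"
      by blast
  qed
qed

section \<open>The dichotomy for maximal solutions\<close>

lemma solves_imp_flow_on:
  assumes "solves G p a u0 T u"
  shows "flow_on T (\<lambda>t. vec_lambda (u t))"
proof -
  obtain v where v: "\<And>x t. t \<in> time_interval T \<Longrightarrow>
        ((\<lambda>s. u s x) has_real_derivative v x t) (at t within time_interval T)"
      "\<And>x t. t \<in> time_interval T \<Longrightarrow> 0 < t \<Longrightarrow>
        v x t = laplacian G (u t) x - a x * u t x + \<bar>u t x\<bar> powr (p - 1) * u t x"
    using assms unfolding solves_def by metis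
  show ?thesis
    unfolding flow_on_def
  proof (intro conjI ballI impI)
    have "continuous_on (time_interval T) (\<lambda>t. u t x)" for x
      using v(1) by (rule DERIV_continuous_on)
    then show "continuous_on (time_interval T) (\<lambda>t. vec_lambda (u t))"
      by (rule continuous_on_vec_lambda)
    fix t assume "t \<in> time_interval T" "0 < t"
    then show "((\<lambda>t. vec_lambda (u t)) has_vector_derivative field (vec_lambda (u t))) (at t)"
      using v[of t] by (simp add: has_vector_derivative_cart field_def at_within_time_interval)
  qed
qed

text \<open>
  The global flow is continuously differentiable, so it is a solution on \<open>[0, \<infinity>)\<close>.
\<close>

lemma stable_T_max:
  assumes "u0 \<in> stable_set G p a"
  shows "T_max G p a u0 = \<infinity>"
proof -
  have "vec_lambda u0 \<in> stable"
    using assms by (simp add: stable_iff)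
  then obtain w where w: "w 0 = vec_lambda u0"
      "\<And>t. t \<ge> 0 \<Longrightarrow> (w has_vector_derivative field (w t)) (at t within {0..})"
    using stable_global_flow by blast
  have deriv: "((\<lambda>t. w t $ x) has_real_derivative field (w t) $ x) (at t within {0..})" if "t \<ge> 0" for t x
    using w(2)[OF that] by (simp add: has_vector_derivative_cart)
  have cont: "continuous_on {0..} (\<lambda>t. w t $ x)" for x
    using deriv by (intro DERIV_continuous_on) auto
  have "continuous_on {0..} (\<lambda>t. field (w t) $ x)" for x
    unfolding field_def laplacian_def using p_gt_1 meas_pos[THEN less_imp_neq]
    by (auto intro!: continuous_intros cont continuous_on_powr')
  then have "solves G p a u0 \<infinity> (\<lambda>t. ($) (w t))"
    unfolding solves_def using deriv w(1)
    by (intro conjI allI exI[of _ "\<lambda>t. field (w t) $ x" for x]) (auto simp: field_def)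
  then have "\<infinity> \<le> T_max G p a u0"
    unfolding T_max_def by (intro Sup_upper) blast
  then show ?thesis
    by simp
qed

lemma sup_norm_le_norm: "sup_norm (($) w) \<le> norm w" "0 \<le> sup_norm f"
  unfolding sup_norm_def
  by (auto simp: component_le_norm_cart Max_ge_iff intro!: Max.boundedI)

end

theorem theorem2p3:
  fixes G :: "'v::finite weighted_graph"
    and p :: real
    and a :: "'v \<Rightarrow> real"
    and u0 :: "'v \<Rightarrow> real"
    and u :: "real \<Rightarrow> 'v \<Rightarrow> real"
  assumes "connected_weighted_graph G"
    and "p > 1"
    and "\<And>x. a x \<ge> 0"
    and "\<exists>x. a x \<noteq> 0"
    and "solves G p a u0 (T_max G p a u0) u"
  shows "(u0 \<in> stable_set G p a \<longrightarrow>
            T_max G p a u0 = \<infinity> \<and>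
            (\<forall>t>0. u t \<in> stable_set G p a) \<and>
            ((\<lambda>t. sup_norm (u t)) \<longlongrightarrow> 0) at_top) \<and>
         (u0 \<in> unstable_set G p a \<longrightarrow> T_max G p a u0 < \<infinity>)"
proof -
  interpret connected_weighted_graph G by fact
  interpret potential_well G p a
    using assms(2-4) by unfold_locales
  define w where "w t = vec_lambda (u t)" for t
  have flow: "flow_on (T_max G p a u0) w"
    unfolding w_def using assms(5) by (rule solves_imp_flow_on)
  have u: "($) (w t) = u t" for t
    by (simp add: w_def)
  have "u 0 = u0"
    using assms(5) by (auto simp: solves_def)
  then have w0: "($) (w 0) = u0"
    by (simp add: u)
  show ?thesis
  proof (intro conjI impI)
    assume "u0 \<in> stable_set G p a"
    then have T: "T_max G p a u0 = \<infinity>" and st: "w 0 \<in> stable"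
      by (simp_all add: stable_T_max stable_iff w0)
    show "T_max G p a u0 = \<infinity>" by (fact T)
    have flow': "flow_on \<infinity> w"
      using flow T by simp
    show "\<forall>t>0. u t \<in> stable_set G p a"
      using flow_invariant(1)[OF flow' _ st] stable_iff u by (metis atLeast_iff less_imp_le time_interval_infinity)
    show "((\<lambda>t. sup_norm (u t)) \<longlongrightarrow> 0) at_top"
      using stable_flow_decay[OF flow' st]
    proof (rule tendsto_0_le[where K = 1], intro always_eventually allI)
      show "norm (sup_norm (u t)) \<le> norm (norm (w t)) * 1" for t
        using sup_norm_le_norm(1)[of "w t"] sup_norm_le_norm(2)[of "u t"] by (simp add: u)
    qed
  next
    assume "u0 \<in> unstable_set G p a"
    then have "w 0 \<in> unstable"
      by (simp add: unstable_iff w0)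
    then show "T_max G p a u0 < \<infinity>"
      using unstable_flow_not_global flow by (cases "T_max G p a u0 = \<infinity>") auto
  qed
qed

end
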